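(* Let $\Theta=(\Sigma,\varphi)$ be a connected $\mathbb{T}$-gain graph of order $n$ with a vertex ordering $<$. The following are equivalent: (i) $\det(DL^{\max}_{<}(\Theta))=0$; (ii) $\det(DL^{\min}_{<}(\Theta))=0$; (iii) $DL^{\max}_{<}(\Theta)=DL^{\min}_{<}(\Theta)$ and the common matrix $DL(\Theta)$ satisfies $\det(DL(\Theta))=0$; (iv) $\Theta$ is balanced. Moreover, if $\Theta$ is balanced then $DL^{\max}_{<}(\Theta)$ and $DL^{\min}_{<}(\Theta)$ have rank $n-1$, and if $\Theta$ is unbalanced they have rank $n$.
   Context: $\mathbb{T}=\{z\in\mathbb{C}:|z|=1\}$. A $\mathbb{T}$-gain graph $\Theta=(\Sigma,\varphi)$: simple finite graph $\Sigma$ with vertices $v_1,\dots,v_n$, $\varphi$ from oriented edges to $\mathbb{T}$ with $\varphi(\vec e_{k,j})=\varphi(\vec e_{j,k})^{-1}$; gain of an oriented path or cycle = product of the gains of its edges in order. $\Theta$ is balanced if every cycle has gain $1$. $d$ is graph distance. For $y<z$, $\varphi^{\max}_{<}(y,z)$ (resp. $\varphi^{\min}_{<}(y,z)$) is the maximum (resp. minimum), in the lexicographic order on $\mathbb{C}$ (real part first, then imaginary part), of the gains of the shortest paths from $y$ to $z$; $\varphi^{\max}_{<}(z,y)=\overline{\varphi^{\max}_{<}(y,z)}$, likewise for min. $D^{\max}_{<}(\Theta)$ has $(s,t)$ entry $\varphi^{\max}_{<}(v_s,v_t)d(v_s,v_t)$ for $s\ne t$ and $0$ on the diagonal; $D^{\min}_{<}$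 similarly. $Tr(\Sigma)=\mathrm{diag}(tr(v_j))$ with $tr(v)=\sum_u d(v,u)$. $DL^{\max}_{<}(\Theta)=Tr(\Sigma)-D^{\max}_{<}(\Theta)$, $DL^{\min}_{<}(\Theta)=Tr(\Sigma)-D^{\min}_{<}(\Theta)$. *)

theory Defs
  imports
    Complex_Main
    "Graph_Theory.Graph_Theory"
    "Jordan_Normal_Form.DL_Rank"
begin

text \<open>A simple finite graph is a \<^locale>\<open>pair_graph\<close>: a finite, loop-free digraph whose arc set is
  symmetric. Its arcs are the oriented edges, so that each undirected edge contributes the two arcs
  \<open>(u, v)\<close> and \<open>(v, u)\<close>.\<close>

locale T_gain_graph = pair_graph G for G :: "'a pair_pre_digraph" +
  fixes \<phi> :: "'a \<times> 'a \<Rightarrow> complex"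
  assumes gain_unit: "e \<in> parcs G \<Longrightarrow> cmod (\<phi> e) = 1"
    and gain_rev: "(u, v) \<in> parcs G \<Longrightarrow> \<phi> (v, u) = inverse (\<phi> (u, v))"

definition gain :: "('a \<times> 'a \<Rightarrow> complex) \<Rightarrow> ('a \<times> 'a) list \<Rightarrow> complex" where
  "gain \<phi> p = prod_list (map \<phi> p)"

text \<open>\<^const>\<open>pre_digraph.cycle\<close> also holds for the back-and-forth walk along a single edge, which is not
  a cycle of the undirected graph; hence the bound on the length.\<close>

definition balanced :: "'a pair_pre_digraph \<Rightarrow> ('a \<times> 'a \<Rightarrow> complex) \<Rightarrow> bool" where
  "balanced G \<phi> \<longleftrightarrow> (\<forall>p. pre_digraph.cycle G p \<and> length p \<ge> 3 \<longrightarrow> gain \<phi> p = 1)"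

definition gdist :: "'a pair_pre_digraph \<Rightarrow> 'a \<Rightarrow> 'a \<Rightarrow> nat" where
  "gdist G u v = (LEAST k. \<exists>p. pre_digraph.apath G u p v \<and> length p = k)"

definition shortest_paths :: "'a pair_pre_digraph \<Rightarrow> 'a \<Rightarrow> 'a \<Rightarrow> ('a \<times> 'a) list set" where
  "shortest_paths G u v = {p. pre_digraph.apath G u p v \<and> length p = gdist G u v}"

definition lex_le :: "complex \<Rightarrow> complex \<Rightarrow> bool" where
  "lex_le z w \<longleftrightarrow> Re z < Re w \<or> (Re z = Re w \<and> Im z \<le> Im w)"

definition lex_Max :: "complex set \<Rightarrow> complex" where
  "lex_Max S = (THE z. z \<in> S \<and> (\<forall>w\<in>S. lex_le w z))"

definition lex_Min :: "complex set \<Rightarrow> complex" where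
  "lex_Min S = (THE z. z \<in> S \<and> (\<forall>w\<in>S. lex_le z w))"

lemma lex_le_antisym: "lex_le z w \<Longrightarrow> lex_le w z \<Longrightarrow> z = w"
  by (auto simp: lex_le_def complex_eq_iff)

lemma lex_Max_eqI: "z \<in> S \<Longrightarrow> (\<And>w. w \<in> S \<Longrightarrow> lex_le w z) \<Longrightarrow> lex_Max S = z"
  unfolding lex_Max_def by (rule the_equality) (auto intro: lex_le_antisym)

lemma lex_Min_eqI: "z \<in> S \<Longrightarrow> (\<And>w. w \<in> S \<Longrightarrow> lex_le z w) \<Longrightarrow> lex_Min S = z"
  unfolding lex_Min_def by (rule the_equality) (auto intro: lex_le_antisym)

text \<open>The strict vertex ordering is the relation \<open>r\<close>, with \<open>(y, z) \<in> r\<close> for \<open>y < z\<close>. The values at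
  \<open>y = z\<close> are irrelevant: the distance matrices below have zero diagonal.\<close>

definition gain_max ::
  "'a pair_pre_digraph \<Rightarrow> ('a \<times> 'a \<Rightarrow> complex) \<Rightarrow> 'a rel \<Rightarrow> 'a \<Rightarrow> 'a \<Rightarrow> complex" where
  "gain_max G \<phi> r y z =
    (if (y, z) \<in> r then lex_Max (gain \<phi> ` shortest_paths G y z)
     else cnj (lex_Max (gain \<phi> ` shortest_paths G z y)))"

definition gain_min ::
  "'a pair_pre_digraph \<Rightarrow> ('a \<times> 'a \<Rightarrow> complex) \<Rightarrow> 'a rel \<Rightarrow> 'a \<Rightarrow> 'a \<Rightarrow> complex" where
  "gain_min G \<phi> r y z =
    (if (y, z) \<in> r then lex_Min (gain \<phi> ` shortest_paths G y z)
     else cnj (lex_Min (gain \<phi> ` shortest_paths G z y)))"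

text \<open>The list \<open>vs\<close> enumerates the vertices \<open>v\<^sub>1, \<dots>, v\<^sub>n\<close>; matrix indices start from \<open>0\<close>.\<close>

definition D_max ::
  "'a pair_pre_digraph \<Rightarrow> ('a \<times> 'a \<Rightarrow> complex) \<Rightarrow> 'a rel \<Rightarrow> 'a list \<Rightarrow> complex mat" where
  "D_max G \<phi> r vs = mat (length vs) (length vs) (\<lambda>(s, t).
     if s = t then 0 else gain_max G \<phi> r (vs ! s) (vs ! t) * of_nat (gdist G (vs ! s) (vs ! t)))"

definition D_min ::
  "'a pair_pre_digraph \<Rightarrow> ('a \<times> 'a \<Rightarrow> complex) \<Rightarrow> 'a rel \<Rightarrow> 'a list \<Rightarrow> complex mat" where
  "D_min G \<phi> r vs = mat (length vs) (length vs) (\<lambda>(s, t).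
     if s = t then 0 else gain_min G \<phi> r (vs ! s) (vs ! t) * of_nat (gdist G (vs ! s) (vs ! t)))"

definition transmission :: "'a pair_pre_digraph \<Rightarrow> 'a \<Rightarrow> nat" where
  "transmission G v = (\<Sum>u\<in>pverts G. gdist G v u)"

definition Tr_mat :: "'a pair_pre_digraph \<Rightarrow> 'a list \<Rightarrow> complex mat" where
  "Tr_mat G vs = mat (length vs) (length vs) (\<lambda>(s, t).
     if s = t then of_nat (transmission G (vs ! s)) else 0)"

definition DL_max ::
  "'a pair_pre_digraph \<Rightarrow> ('a \<times> 'a \<Rightarrow> complex) \<Rightarrow> 'a rel \<Rightarrow> 'a list \<Rightarrow> complex mat" where
  "DL_max G \<phi> r vs = Tr_mat G vs - D_max G \<phi> r vs"

definition DL_min ::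
  "'a pair_pre_digraph \<Rightarrow> ('a \<times> 'a \<Rightarrow> complex) \<Rightarrow> 'a rel \<Rightarrow> 'a list \<Rightarrow> complex mat" where
  "DL_min G \<phi> r vs = Tr_mat G vs - D_min G \<phi> r vs"

end

theory Submission
  imports Defs
begin

text \<open>Call \<open>f\<close> a potential if \<open>f u = \<phi> (u, v) * f v\<close> on every arc \<open>(u, v)\<close>. Let \<open>h y z\<close> be the gain of
  any chosen shortest path from \<open>y\<close> to \<open>z\<close>, and let \<open>L\<close> be the Laplacian built from \<open>h\<close>. Since
  \<open>h y z\<close> is unimodular and the distance is symmetric, twice the real part of the form \<open>x\<^sup>* L x\<close> equals
  \<open>\<Sum>y z. d y z * \<bar>x y - h y z * x z\<bar>\<^sup>2\<close>. So the kernel of \<open>L\<close> consists exactly of the potentials,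
  whatever the choice of \<open>h\<close>. On a connected graph a potential that vanishes at one vertex
  is zero, so the kernel has dimension at most one, and a nonzero potential exists if and only if
  the graph is balanced; it then forces \<open>h y z = f y / f z\<close>.\<close>

section \<open>Greatest and least elements in the lexicographic order\<close>

lemma lex_le_trans: "lex_le a b \<Longrightarrow> lex_le b c \<Longrightarrow> lex_le a c"
  by (auto simp: lex_le_def)

lemma lex_le_linear: "lex_le a b \<or> lex_le b a"
  by (auto simp: lex_le_def)

lemma finite_has_lex_greatest:
  assumes "finite S" "S \<noteq> {}"
  shows "\<exists>z\<in>S. \<forall>w\<in>S. lex_le w z"
  using assms
proof (induction S rule: finite_ne_induct)
  case (insert x S)
  then obtain z where "z \<in> S" "\<forall>w\<in>S. lex_le w z" by blast
  then show ?case
    using lex_le_linear[of x z] lex_le_linear[of x x] by (metis insert_iff lex_le_trans)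
qed (auto simp: lex_le_def)

lemma finite_has_lex_least:
  assumes "finite S" "S \<noteq> {}"
  shows "\<exists>z\<in>S. \<forall>w\<in>S. lex_le z w"
  using assms
proof (induction S rule: finite_ne_induct)
  case (insert x S)
  then obtain z where "z \<in> S" "\<forall>w\<in>S. lex_le z w" by blast
  then show ?case
    using lex_le_linear[of x z] lex_le_linear[of x x] by (metis insert_iff lex_le_trans)
qed (auto simp: lex_le_def)

text \<open>\<open>lex_Max\<close> is a definite description, so it is meaningful only once a
  greatest element is known to exist; antisymmetry makes it unique.\<close>

lemma lex_Max_in: "finite S \<Longrightarrow> S \<noteq> {} \<Longrightarrow> lex_Max S \<in> S"
  using finite_has_lex_greatest[of S] lex_Max_eqI by metis

lemma lex_Min_in: "finite S \<Longrightarrow> S \<noteq> {} \<Longrightarrow> lex_Min S \<in> S"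
  using finite_has_lex_least[of S] lex_Min_eqI by metis

section \<open>Path algebra, and a rank bound from the kernel\<close>

lemma gain_simps [simp]:
  "gain \<phi> [] = 1" "gain \<phi> (e # p) = \<phi> e * gain \<phi> p" "gain \<phi> (p @ q) = gain \<phi> p * gain \<phi> q"
  by (simp_all add: gain_def)

lemma length_rev_path [simp]: "length (rev_path p) = length p"
  by (induction p) auto

text \<open>Deleting column 0 leaves a matrix whose kernel embeds into the part of the kernel of
  \<open>A\<close> with first entry 0. Hence the remaining \<open>n - 1\<close> columns are
  independent.\<close>

lemma (in vec_space) rank_ge_pred_if_kernel_trivial_on_hyperplane:
  assumes A: "A \<in> carrier_mat n n" and n: "n > 0"
    and ker: "\<And>x. x \<in> carrier_vec n \<Longrightarrow> A *\<^sub>v x = 0\<^sub>v n \<Longrightarrow> x $ 0 = 0 \<Longrightarrow> x = 0\<^sub>v n"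
  shows "n - 1 \<le> rank A"
proof -
  define B where "B = mat n (n - 1) (\<lambda>(i, j). A $$ (i, Suc j))"
  have B: "B \<in> carrier_mat n (n - 1)" by (simp add: B_def)
  have B_ker: "v = 0\<^sub>v (n - 1)" if v: "v \<in> carrier_vec (n - 1)" "B *\<^sub>v v = 0\<^sub>v n" for v
  proof -
    \<comment> \<open>Padding \<open>v\<close> with a leading 0 turns the product with
      \<open>B\<close> into one with \<open>A\<close>, so that \<open>ker\<close> applies.\<close>
    define x where "x = vec n (\<lambda>i. if i = 0 then 0 else v $ (i - 1))"
    have "A *\<^sub>v x = B *\<^sub>v v"
    proof (rule eq_vecI)
      fix i assume "i < dim_vec (B *\<^sub>v v)"
      then have i: "i < n" by (simp add: B_def)
      have "(A *\<^sub>v x) $ i = (\<Sum>j<n. A $$ (i, j) * x $ j)"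
        using A i by (simp add: scalar_prod_def x_def atLeast0LessThan)
      also have "\<dots> = (\<Sum>j<Suc (n - 1). A $$ (i, j) * x $ j)"
        using n by simp
      also have "\<dots> = (\<Sum>j<n - 1. A $$ (i, Suc j) * v $ j)"
        unfolding sum.lessThan_Suc_shift using n by (simp add: x_def)
      also have "\<dots> = (B *\<^sub>v v) $ i"
        using v(1) i by (simp add: scalar_prod_def B_def atLeast0LessThan)
      finally show "(A *\<^sub>v x) $ i = (B *\<^sub>v v) $ i" .
    qed (use A in \<open>simp add: B_def\<close>)
    then have "x = 0\<^sub>v n"
      using v(2) n by (intro ker[of x]) (simp_all add: x_def)
    then have "x $ Suc i = 0" if "i < n - 1" for i
      using that by simp
    then show ?thesis
      using v by (intro eq_vecI) (auto simp: x_def)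
  qed
  \<comment> \<open>Independence is a property of the set of columns, which forgets repetitions.
    Equal columns \<open>i\<close> and \<open>j\<close> would put a difference of two unit vectors
    into the kernel.\<close>
  have dist: "distinct (cols B)"
  proof (rule ccontr)
    assume "\<not> distinct (cols B)"
    then obtain i j where ij: "i < n - 1" "j < n - 1" "i \<noteq> j" "col B i = col B j"
      using B by (auto simp: distinct_conv_nth)
    define v where "v = unit_vec (n - 1) i - (unit_vec (n - 1) j :: 'a vec)"
    have "B *\<^sub>v v = col B i - col B j"
    proof (rule eq_vecI)
      fix k assume "k < dim_vec (col B i - col B j)"
      then have k: "k < n" using B by simp
      have "row B k \<bullet> v = row B k \<bullet> unit_vec (n - 1) i - row B k \<bullet> unit_vec (n - 1) j"
        unfolding v_def
        by (rule scalar_prod_minus_distrib[OF row_carrier_vec[OF k B]]) simp_all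
      also have "\<dots> = row B k $ i - row B k $ j"
        using row_carrier_vec[OF k B] ij by (simp only: scalar_prod_right_unit)
      finally show "(B *\<^sub>v v) $ k = (col B i - col B j) $ k"
        using B ij(1,2) k by simp
    qed (use B in simp)
    also have "\<dots> = 0\<^sub>v n"
      using ij B by auto
    finally have "v = 0\<^sub>v (n - 1)"
      by (intro B_ker[of v]) (simp_all add: v_def)
    then have "v $ i = 0"
      using ij by simp
    then show False
      using ij by (simp add: v_def)
  qed
  have "lin_indpt (set (cols B))"
    using lin_depE[OF B _ dist] B_ker by metis
  moreover have "set (cols B) \<subseteq> set (cols A)"
  proof
    fix c assume "c \<in> set (cols B)"
    then obtain j where j: "j < n - 1" "c = col B j"
      using B by (auto simp: cols_def)
    then have "c = col A (Suc j)"
      using A by (auto simp: B_def)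
    then show "c \<in> set (cols A)"
      using j A by (auto simp: cols_def)
  qed
  ultimately have "card (set (cols B)) \<le> rank A"
    using rank_ge_card_indpt[OF A] by blast
  then show ?thesis
    using distinct_card[OF dist] B by simp
qed

section \<open>Laplacians for arbitrary choices of shortest paths\<close>

definition DL_of ::
  "'a pair_pre_digraph \<Rightarrow> ('a \<Rightarrow> 'a \<Rightarrow> complex) \<Rightarrow> 'a list \<Rightarrow> complex mat" where
  "DL_of G h vs = mat (length vs) (length vs) (\<lambda>(s, t).
     if s = t then of_nat (transmission G (vs ! s))
     else - (h (vs ! s) (vs ! t) * of_nat (gdist G (vs ! s) (vs ! t))))"

lemma DL_of_carrier: "DL_of G h vs \<in> carrier_mat (length vs) (length vs)"
  by (simp add: DL_of_def)

text \<open>With both Laplacians as instances of \<open>DL_of\<close>, one kernel computation serves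
  for the maximum and the minimum.\<close>

lemma DL_max_eq_DL_of: "DL_max G \<phi> r vs = DL_of G (gain_max G \<phi> r) vs"
  by (rule eq_matI) (auto simp: DL_max_def DL_of_def Tr_mat_def D_max_def)

lemma DL_min_eq_DL_of: "DL_min G \<phi> r vs = DL_of G (gain_min G \<phi> r) vs"
  by (rule eq_matI) (auto simp: DL_min_def DL_of_def Tr_mat_def D_min_def)

text \<open>On a connected graph, a nonzero potential is up to scaling a switching function that
  turns every gain into 1.\<close>

definition potential ::
  "'a pair_pre_digraph \<Rightarrow> ('a \<times> 'a \<Rightarrow> complex) \<Rightarrow> ('a \<Rightarrow> complex) \<Rightarrow> bool" where
  "potential G \<phi> f \<longleftrightarrow> (\<forall>(u, v)\<in>parcs G. f u = \<phi> (u, v) * f v)"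

text \<open>The pairs \<open>(y, z)\<close> and \<open>(z, y)\<close> may use unrelated paths, so
  \<open>DL_of\<close> need not be Hermitian; hence the real part in the quadratic form.\<close>

definition shortest_path_gain ::
  "'a pair_pre_digraph \<Rightarrow> ('a \<times> 'a \<Rightarrow> complex) \<Rightarrow> ('a \<Rightarrow> 'a \<Rightarrow> complex) \<Rightarrow> bool" where
  "shortest_path_gain G \<phi> h \<longleftrightarrow>
     (\<forall>y\<in>pverts G. \<forall>z\<in>pverts G. h y z \<in> gain \<phi> ` shortest_paths G y z)"

section \<open>Gains of walks and of shortest paths\<close>

context T_gain_graph
begin

text \<open>The inverse of a unimodular number is its conjugate, so reversing an arc conjugates its
  gain.\<close>

lemma gain_rev_path: "awalk u p v \<Longrightarrow> gain \<phi> (rev_path p) = cnj (gain \<phi> p)"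
proof (induction p arbitrary: u)
  case (Cons e p)
  obtain a b where e: "e = (a, b)" by fastforce
  with Cons.prems have arc: "(a, b) \<in> parcs G" and "awalk b p v"
    by (auto simp: awalk_Cons_iff)
  have "\<phi> (b, a) = cnj (\<phi> (a, b))"
    using gain_unit[OF arc] gain_rev[OF arc]
    by (simp add: inverse_eq_divide complex_div_cnj[of 1])
  then show ?case
    using Cons.IH[OF \<open>awalk b p v\<close>] by (simp add: e)
qed simp

lemma cmod_gain: "awalk u p v \<Longrightarrow> cmod (gain \<phi> p) = 1"
  by (induction p arbitrary: u) (auto simp: awalk_Cons_iff gain_unit norm_mult)

text \<open>The arc equations telescope along the walk.\<close>

lemma potential_awalk:
  assumes "potential G \<phi> f"
  shows "awalk u p v \<Longrightarrow> f u = gain \<phi> p * f v"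
proof (induction p arbitrary: u)
  case (Cons e p)
  then show ?case
    using assms by (cases e) (auto simp: awalk_Cons_iff potential_def)
qed (auto simp: awalk_Nil_iff)

text \<open>Extends balance from cycles to closed walks by strong induction on the length, cutting a
  walk at a repeated vertex.\<close>

lemma gain_closed_awalk:
  assumes "balanced G \<phi>"
  shows "awalk u p u \<Longrightarrow> gain \<phi> p = 1"
proof (induction "length p" arbitrary: u p rule: less_induct)
  case less
  show ?case
  proof (cases p)
    case (Cons e es)
    show ?thesis
    \<comment> \<open>The first visit to \<open>u\<close> is left out of the test, since a closed
      walk ends at \<open>u\<close> again.\<close>
    proof (cases "distinct (awalk_verts (snd e) es)")
      case True
      then have cyc: "cycle p"
        using less.prems by (auto simp: cycle_def Cons awalk_Cons_iff)
      show ?thesis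
      proof (cases "length p \<ge> 3")
        case True
        with cyc assms show ?thesis by (simp add: balanced_def)
      next
        case False
        \<comment> \<open>\<open>balanced\<close> says nothing about cycles this short: the walk
          runs along one edge and back, and the two gains are inverse to each other.\<close>
        from cyc have "length p \<ge> 2" by (auto simp: cycle_digraph_conv)
        with False obtain e' where p: "p = [e, e']"
          unfolding Cons by (cases es; cases "tl es") auto
        with less.prems have "e \<in> parcs G" "e' = (snd e, fst e)"
          by (auto simp: awalk_simps prod_eq_iff)
        then show ?thesis
          using gain_rev[of "fst e" "snd e"] gain_unit[of e] by (cases "\<phi> e = 0") (auto simp: p)
      qed
    next
      case False
      have "awalk (snd e) es u"
        using less.prems by (auto simp: Cons awalk_Cons_iff)
      \<comment> \<open>Both closed pieces are shorter than \<open>p\<close>: \<open>r\<close> lacks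
        the arc \<open>e\<close>, and the rest lacks the nonempty \<open>r\<close>.\<close>
      from awalk_not_distinct_decomp[OF this False] obtain q r s w where
        es: "es = q @ r @ s" and "0 < length r"
        and w: "awalk (snd e) q w" "awalk w r w" "awalk w s u"
        by blast
      have "gain \<phi> r = 1"
        using w by (intro less.hyps) (auto simp: Cons es)
      moreover have "awalk u ((e # q) @ s) u"
        using less.prems w by (intro awalk_appendI) (auto simp: Cons awalk_Cons_iff)
      then have "gain \<phi> ((e # q) @ s) = 1"
        using \<open>0 < length r\<close> by (intro less.hyps) (auto simp: Cons es)
      ultimately show ?thesis
        by (simp add: Cons es)
    qed
  qed simp
qed

lemma gdist_le: "apath u p v \<Longrightarrow> gdist G u v \<le> length p"
  unfolding gdist_def by (rule Least_le) blast

lemma gdist_self: "u \<in> pverts G \<Longrightarrow> gdist G u u = 0"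
  using gdist_le[of u "[]" u] by (simp add: apath_Nil_iff)

lemma gdist_commute: "gdist G u v = gdist G v u"
proof -
  have "(\<exists>p. apath u p v \<and> length p = k) = (\<exists>p. apath v p u \<and> length p = k)" for k
    by (metis apath_rev_path length_rev_path)
  then show ?thesis
    by (simp add: gdist_def)
qed

lemma shortest_paths_rev_path:
  "p \<in> shortest_paths G u v \<Longrightarrow> rev_path p \<in> shortest_paths G v u"
  by (simp add: shortest_paths_def gdist_commute)

lemma shortest_pathsD:
  assumes "p \<in> shortest_paths G u v"
  shows "awalk u p v" "length p = gdist G u v"
  using assms by (auto simp: shortest_paths_def apath_def)

lemma finite_shortest_paths: "finite (shortest_paths G u v)"
  using apaths_finite[of u v] by (rule rev_finite_subset) (auto simp: shortest_paths_def)

text \<open>The arc is itself a path of length 1, and it is the only arc from \<open>u\<close> to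
  \<open>v\<close>. Thus any choice of shortest paths reproduces \<open>\<phi>\<close> on
  arcs.\<close>

lemma shortest_paths_arc:
  assumes "(u, v) \<in> parcs G" "p \<in> shortest_paths G u v"
  shows "p = [(u, v)]"
proof -
  have "u \<noteq> v"
    using assms(1) by (rule no_loops')
  then have "apath u [(u, v)] v"
    using assms(1) by (auto simp: apath_simps dest: in_arcsD2)
  then have "length p \<le> 1"
    using gdist_le assms(2) by (fastforce dest: shortest_pathsD)
  then show ?thesis
    using shortest_pathsD(1)[OF assms(2)] \<open>u \<noteq> v\<close>
    by (cases p) (auto simp: awalk_simps)
qed

end

section \<open>Connectedness, balance and potentials\<close>

locale connected_T_gain_graph = T_gain_graph +
  assumes conn: "Digraph_Component.connected G"
begin

lemma reachable: "u \<in> pverts G \<Longrightarrow> v \<in> pverts G \<Longrightarrow> u \<rightarrow>\<^sup>*\<^bsub>with_proj G\<^esub> v"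
  using symmetric_connected_imp_strongly_connected[OF sym_arcs conn]
  by (auto simp: strongly_connected_def)

lemma ex_awalk: "u \<in> pverts G \<Longrightarrow> v \<in> pverts G \<Longrightarrow> \<exists>p. awalk u p v"
  using reachable by (simp add: reachable_awalk)

lemma pverts_nonempty: "pverts G \<noteq> {}"
  using symmetric_connected_imp_strongly_connected[OF sym_arcs conn]
  by (auto simp: strongly_connected_def)

lemma shortest_paths_nonempty:
  assumes "u \<in> pverts G" "v \<in> pverts G"
  shows "shortest_paths G u v \<noteq> {}"
proof -
  have "\<exists>k p. apath u p v \<and> length p = k"
    using reachable[OF assms] by (auto simp: reachable_apath)
  from LeastI_ex[OF this] show ?thesis
    by (auto simp: shortest_paths_def gdist_def)
qed

lemma gdist_pos:
  assumes "(u, v) \<in> parcs G"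
  shows "gdist G u v > 0"
proof -
  obtain p where "p \<in> shortest_paths G u v"
    using shortest_paths_nonempty assms by (blast dest: in_arcsD1 in_arcsD2)
  with shortest_paths_arc[OF assms] show ?thesis
    by (fastforce dest: shortest_pathsD)
qed

text \<open>In the conjugated case of \<open>gain_max\<close>, the value is the gain of a reversed
  path, which is again shortest because distance is symmetric.\<close>

lemma shortest_path_gain_max: "shortest_path_gain G \<phi> (gain_max G \<phi> r)"
  unfolding shortest_path_gain_def
proof (intro ballI)
  fix y z assume yz: "y \<in> pverts G" "z \<in> pverts G"
  have *: "lex_Max (gain \<phi> ` shortest_paths G u v) \<in> gain \<phi> ` shortest_paths G u v"
    if "u \<in> pverts G" "v \<in> pverts G" for u v
    using finite_shortest_paths shortest_paths_nonempty[OF that] by (intro lex_Max_in) auto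
  then obtain p where "p \<in> shortest_paths G z y"
    "lex_Max (gain \<phi> ` shortest_paths G z y) = gain \<phi> p"
    using yz by blast
  then have "cnj (lex_Max (gain \<phi> ` shortest_paths G z y)) \<in> gain \<phi> ` shortest_paths G y z"
    by (metis gain_rev_path image_eqI shortest_pathsD(1) shortest_paths_rev_path)
  with * yz show "gain_max G \<phi> r y z \<in> gain \<phi> ` shortest_paths G y z"
    by (simp add: gain_max_def)
qed

lemma shortest_path_gain_min: "shortest_path_gain G \<phi> (gain_min G \<phi> r)"
  unfolding shortest_path_gain_def
proof (intro ballI)
  fix y z assume yz: "y \<in> pverts G" "z \<in> pverts G"
  have *: "lex_Min (gain \<phi> ` shortest_paths G u v) \<in> gain \<phi> ` shortest_paths G u v"
    if "u \<in> pverts G" "v \<in> pverts G" for u v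
    using finite_shortest_paths shortest_paths_nonempty[OF that] by (intro lex_Min_in) auto
  then obtain p where "p \<in> shortest_paths G z y"
    "lex_Min (gain \<phi> ` shortest_paths G z y) = gain \<phi> p"
    using yz by blast
  then have "cnj (lex_Min (gain \<phi> ` shortest_paths G z y)) \<in> gain \<phi> ` shortest_paths G y z"
    by (metis gain_rev_path image_eqI shortest_pathsD(1) shortest_paths_rev_path)
  with * yz show "gain_min G \<phi> r y z \<in> gain \<phi> ` shortest_paths G y z"
    by (simp add: gain_min_def)
qed

text \<open>A zero at \<open>v\<close> would propagate along a walk from \<open>u\<close> to
  \<open>v\<close>.\<close>

lemma potential_nowhere_zero:
  assumes "potential G \<phi> f" "u \<in> pverts G" "f u \<noteq> 0" "v \<in> pverts G"
  shows "f v \<noteq> 0"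
  using potential_awalk[OF assms(1)] ex_awalk[OF assms(2,4)] assms(3) by fastforce

text \<open>Balance makes the gain of a walk to a fixed root independent of the walk, and this gain
  is a potential. Conversely, going once around a cycle multiplies a nonzero value by the gain of
  the cycle and must return the same value.\<close>

lemma balanced_iff_potential:
  "balanced G \<phi> \<longleftrightarrow> (\<exists>f. potential G \<phi> f \<and> (\<exists>v\<in>pverts G. f v \<noteq> 0))"
proof
  assume bal: "balanced G \<phi>"
  obtain w where w: "w \<in> pverts G"
    using pverts_nonempty by blast
  define P where "P v = (SOME p. awalk v p w)" for v
  have P: "awalk v (P v) w" if "v \<in> pverts G" for v
    unfolding P_def using ex_awalk[OF that w] by (rule someI_ex)
  have "potential G \<phi> (\<lambda>v. gain \<phi> (P v))"
    unfolding potential_def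
  proof clarify
    fix u v assume arc: "(u, v) \<in> parcs G"
    then have u: "u \<in> pverts G" and v: "v \<in> pverts G"
      by (auto dest: in_arcsD1 in_arcsD2)
    have "awalk u ((u, v) # P v) w"
      using arc P[OF v] by (simp add: awalk_Cons_iff)
    moreover have "awalk w (rev_path (P u)) u"
      using P[OF u] by simp
    \<comment> \<open>Along the arc, down to the root by \<open>P v\<close>, and back to
      \<open>u\<close> by the reverse of \<open>P u\<close>: the trivial gain of this closed walk is
      the arc equation.\<close>
    ultimately have "awalk u (((u, v) # P v) @ rev_path (P u)) u"
      by (rule awalk_appendI)
    from gain_closed_awalk[OF bal this]
    have *: "\<phi> (u, v) * gain \<phi> (P v) * cnj (gain \<phi> (P u)) = 1"
      using gain_rev_path[OF P[OF u]] by (simp add: mult.assoc)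
    have "gain \<phi> (P u) * cnj (gain \<phi> (P u)) = 1"
      using cmod_gain[OF P[OF u]] by (simp add: complex_norm_square[symmetric])
    with * show "gain \<phi> (P u) = \<phi> (u, v) * gain \<phi> (P v)"
      by (metis mult_cancel_right mult_zero_right zero_neq_one)
  qed
  moreover have "gain \<phi> (P w) \<noteq> 0"
    using cmod_gain[OF P[OF w]] by auto
  ultimately show "\<exists>f. potential G \<phi> f \<and> (\<exists>v\<in>pverts G. f v \<noteq> 0)"
    using w by blast
next
  assume "\<exists>f. potential G \<phi> f \<and> (\<exists>v\<in>pverts G. f v \<noteq> 0)"
  then obtain f v where f: "potential G \<phi> f" "v \<in> pverts G" "f v \<noteq> 0"
    by blast
  show "balanced G \<phi>"
    unfolding balanced_def
  proof clarify
    fix p assume "cycle p"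
    then obtain u where u: "awalk u p u"
      by (auto simp: cycle_def)
    then have "f u \<noteq> 0"
      using potential_nowhere_zero[OF f] by (auto dest: awalk_hd_in_verts)
    with potential_awalk[OF f(1) u] show "gain \<phi> p = 1"
      by simp
  qed
qed

lemma shortest_path_gain_potential:
  assumes "shortest_path_gain G \<phi> h" "potential G \<phi> f" "u \<in> pverts G" "v \<in> pverts G"
  shows "f u = h u v * f v"
proof -
  obtain p where "p \<in> shortest_paths G u v" "h u v = gain \<phi> p"
    using assms by (auto simp: shortest_path_gain_def)
  then show ?thesis
    using potential_awalk[OF assms(2)] shortest_pathsD(1) by metis
qed

lemma cmod_shortest_path_gain:
  assumes "shortest_path_gain G \<phi> h" "u \<in> pverts G" "v \<in> pverts G"
  shows "cmod (h u v) = 1"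
  using assms cmod_gain by (fastforce simp: shortest_path_gain_def dest: shortest_pathsD)

lemma shortest_path_gain_arc:
  assumes "shortest_path_gain G \<phi> h" "(u, v) \<in> parcs G"
  shows "h u v = \<phi> (u, v)"
proof -
  obtain p where "p \<in> shortest_paths G u v" "h u v = gain \<phi> p"
    using assms in_arcsD1[OF assms(2)] in_arcsD2[OF assms(2)]
    by (auto simp: shortest_path_gain_def)
  with shortest_paths_arc[OF assms(2)] show ?thesis
    by fastforce
qed

end

section \<open>Kernel, determinant and rank of the Laplacian\<close>

locale enumerated_gain_graph = connected_T_gain_graph +
  fixes vs :: "'a list"
  assumes vs_distinct: "distinct vs" and set_vs: "set vs = pverts G"
begin

lemma nth_vs [simp]: "i < length vs \<Longrightarrow> vs ! i \<in> pverts G"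
  using set_vs nth_mem by blast

lemma sum_vs: "(\<Sum>t<length vs. F (vs ! t)) = (\<Sum>v\<in>pverts G. F v)"
  using sum.reindex_bij_betw[OF bij_betw_nth[OF vs_distinct refl refl]] set_vs by simp

text \<open>Replaces indices by vertices; distinctness of \<open>vs\<close> makes the position of a
  vertex well defined.\<close>

lemma vec_as_function:
  assumes "x \<in> carrier_vec (length vs)"
  obtains f where "x = vec (length vs) (\<lambda>i. f (vs ! i))"
proof
  show "x = vec (length vs) (\<lambda>i. (\<lambda>v. x $ inv_into {..<length vs} ((!) vs) v) (vs ! i))"
    using assms vs_distinct
    by (intro eq_vecI) (auto simp: inv_into_f_f inj_on_nth)
qed

lemma vec_function_eq_0_iff:
  "vec (length vs) (\<lambda>i. f (vs ! i)) = 0\<^sub>v (length vs) \<longleftrightarrow> (\<forall>v\<in>pverts G. f v = 0)"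
  unfolding set_vs[symmetric] all_set_conv_all_nth by (simp add: vec_eq_iff)

text \<open>The transmission is a row sum of distances, so the diagonal term can be distributed over
  the summands.\<close>

lemma DL_of_mult_vec:
  assumes "s < length vs"
  shows "(DL_of G h vs *\<^sub>v vec (length vs) (\<lambda>i. f (vs ! i))) $ s =
    (\<Sum>v\<in>pverts G. of_nat (gdist G (vs ! s) v) * (f (vs ! s) - h (vs ! s) v * f v))"
proof -
  let ?u = "vs ! s"
  have "(DL_of G h vs *\<^sub>v vec (length vs) (\<lambda>i. f (vs ! i))) $ s =
    (\<Sum>t<length vs. DL_of G h vs $$ (s, t) * f (vs ! t))"
    using assms by (simp add: DL_of_def scalar_prod_def atLeast0LessThan)
  \<comment> \<open>At \<open>t = s\<close> the distance is 0, so subtracting the \<open>h\<close>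
    term there changes nothing and both cases share one formula.\<close>
  also have "\<dots> = (\<Sum>t<length vs. (if s = t then of_nat (transmission G ?u) * f ?u else 0)
      - of_nat (gdist G ?u (vs ! t)) * (h ?u (vs ! t) * f (vs ! t)))"
    using assms by (intro sum.cong) (auto simp: DL_of_def gdist_self)
  also have "\<dots> = of_nat (transmission G ?u) * f ?u
      - (\<Sum>v\<in>pverts G. of_nat (gdist G ?u v) * (h ?u v * f v))"
    using assms sum_vs[of "\<lambda>v. of_nat (gdist G ?u v) * (h ?u v * f v)"]
    by (simp add: sum_subtractf)
  also have "\<dots> = (\<Sum>v\<in>pverts G. of_nat (gdist G ?u v) * (f ?u - h ?u v * f v))"
    by (simp add: transmission_def sum_distrib_right sum_subtractf right_diff_distrib)
  finally show ?thesis .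
qed

lemma DL_of_kernel_iff_potential:
  assumes h: "shortest_path_gain G \<phi> h"
  shows "DL_of G h vs *\<^sub>v vec (length vs) (\<lambda>i. f (vs ! i)) = 0\<^sub>v (length vs) \<longleftrightarrow> potential G \<phi> f"
proof
  let ?V = "pverts G" and ?d = "\<lambda>u v. real (gdist G u v)"
  assume ker: "DL_of G h vs *\<^sub>v vec (length vs) (\<lambda>i. f (vs ! i)) = 0\<^sub>v (length vs)"
  have row: "(\<Sum>v\<in>?V. of_real (?d u v) * (f u - h u v * f v)) = 0" if u: "u \<in> ?V" for u
  proof -
    obtain s where "s < length vs" "u = vs ! s"
      using u set_vs by (metis in_set_conv_nth)
    with DL_of_mult_vec[of s h f] ker show ?thesis
      by simp
  qed
  \<comment> \<open>Expands the square with \<open>a = f u\<close> and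
    \<open>b = h u v * f v\<close>, where \<open>b\<close> has the modulus of
    \<open>f v\<close>.\<close>
  have cmod_diff_sq: "(cmod (f u - h u v * f v))\<^sup>2 =
      2 * Re (cnj (f u) * (f u - h u v * f v)) + (cmod (f v))\<^sup>2 - (cmod (f u))\<^sup>2"
    if "u \<in> ?V" "v \<in> ?V" for u v
  proof -
    have "(cmod (f v))\<^sup>2 = (cmod (h u v * f v))\<^sup>2"
      using cmod_shortest_path_gain[OF h that] by (simp add: norm_mult)
    moreover have "(cmod (a - b))\<^sup>2 = 2 * Re (cnj a * (a - b)) + (cmod b)\<^sup>2 - (cmod a)\<^sup>2"
      for a b :: complex
      by (simp add: cmod_power2) (simp add: power2_eq_square algebra_simps)
    ultimately show ?thesis
      by simp
  qed
  \<comment> \<open>By symmetry of the distance, the two sums of squared moduli cancel.\<close>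
  have swap: "(\<Sum>u\<in>?V. \<Sum>v\<in>?V. ?d u v * (cmod (f v))\<^sup>2) = (\<Sum>u\<in>?V. \<Sum>v\<in>?V. ?d u v * (cmod (f u))\<^sup>2)"
    by (subst sum.swap) (simp add: gdist_commute)
  have "(\<Sum>u\<in>?V. \<Sum>v\<in>?V. ?d u v * (cmod (f u - h u v * f v))\<^sup>2) =
      (\<Sum>u\<in>?V. \<Sum>v\<in>?V. 2 * (?d u v * Re (cnj (f u) * (f u - h u v * f v)))
        + ?d u v * (cmod (f v))\<^sup>2 - ?d u v * (cmod (f u))\<^sup>2)"
    by (intro sum.cong refl) (simp add: cmod_diff_sq right_diff_distrib distrib_left)
  also have "\<dots> = 2 * (\<Sum>u\<in>?V. \<Sum>v\<in>?V. ?d u v * Re (cnj (f u) * (f u - h u v * f v)))"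
    by (simp only: sum.distrib sum_subtractf swap sum_distrib_left[symmetric])
  \<comment> \<open>Real weights pass through \<open>Re\<close>; removing
    \<open>of_real_of_nat_eq\<close> keeps them in the form used by \<open>row\<close>.\<close>
  also have "\<dots> = 2 * (\<Sum>u\<in>?V. Re (cnj (f u) * (\<Sum>v\<in>?V. of_real (?d u v) * (f u - h u v * f v))))"
    by (simp add: sum_distrib_left mult.left_commute[of _ "of_real _"] del: of_real_of_nat_eq)
  also have "\<dots> = 0"
    by (simp add: row del: of_real_of_nat_eq)
  finally have zero: "(\<Sum>u\<in>?V. \<Sum>v\<in>?V. ?d u v * (cmod (f u - h u v * f v))\<^sup>2) = 0" .
  have zero': "?d u v * (cmod (f u - h u v * f v))\<^sup>2 = 0" if "u \<in> ?V" "v \<in> ?V" for u v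
  proof -
    have "(\<Sum>v\<in>?V. ?d u v * (cmod (f u - h u v * f v))\<^sup>2) = 0"
      using zero that pair_finite_verts by (subst (asm) sum_nonneg_eq_0_iff) (auto intro: sum_nonneg)
    then show ?thesis
      using that pair_finite_verts by (subst (asm) sum_nonneg_eq_0_iff) auto
  qed
  show "potential G \<phi> f"
    unfolding potential_def
  proof clarify
    fix u v assume arc: "(u, v) \<in> parcs G"
    \<comment> \<open>Every weighted square vanishes, and on an arc the weight is positive.\<close>
    then have "f u - h u v * f v = 0"
      using zero'[of u v] gdist_pos[OF arc] by (auto dest: in_arcsD1 in_arcsD2)
    then show "f u = \<phi> (u, v) * f v"
      using shortest_path_gain_arc[OF h arc] by simp
  qed
next
  assume f: "potential G \<phi> f"
  show "DL_of G h vs *\<^sub>v vec (length vs) (\<lambda>i. f (vs ! i)) = 0\<^sub>v (length vs)"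
  proof (rule eq_vecI)
    fix s assume "s < dim_vec (0\<^sub>v (length vs))"
    then have s: "s < length vs" by simp
    \<comment> \<open>Each summand of the row is 0, as the potential satisfies its equation along
      every chosen shortest path.\<close>
    show "(DL_of G h vs *\<^sub>v vec (length vs) (\<lambda>i. f (vs ! i))) $ s = 0\<^sub>v (length vs) $ s"
      using s shortest_path_gain_potential[OF h f nth_vs[OF s], symmetric]
      by (simp add: DL_of_mult_vec)
  qed (simp add: DL_of_def)
qed

lemma det_DL_of_eq_0_iff:
  assumes h: "shortest_path_gain G \<phi> h"
  shows "det (DL_of G h vs) = 0 \<longleftrightarrow> balanced G \<phi>"
proof -
  have "det (DL_of G h vs) = 0 \<longleftrightarrow> (\<exists>x. x \<in> carrier_vec (length vs) \<and> x \<noteq> 0\<^sub>v (length vs) \<and>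
      DL_of G h vs *\<^sub>v x = 0\<^sub>v (length vs))"
    by (rule det_0_iff_vec_prod_zero_field[OF DL_of_carrier])
  also have "\<dots> \<longleftrightarrow> (\<exists>f. potential G \<phi> f \<and> (\<exists>v\<in>pverts G. f v \<noteq> 0))"
    (is "?L \<longleftrightarrow> ?R")
  proof
    assume ?L
    then obtain x where x: "x \<in> carrier_vec (length vs)" "x \<noteq> 0\<^sub>v (length vs)"
      "DL_of G h vs *\<^sub>v x = 0\<^sub>v (length vs)"
      by blast
    obtain f where "x = vec (length vs) (\<lambda>i. f (vs ! i))"
      using x(1) by (rule vec_as_function)
    with x show ?R
      by (auto simp: DL_of_kernel_iff_potential[OF h] vec_function_eq_0_iff)
  next
    assume ?R
    then obtain f where "potential G \<phi> f" "\<exists>v\<in>pverts G. f v \<noteq> 0"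
      by blast
    then show ?L
      by (intro exI[of _ "vec (length vs) (\<lambda>i. f (vs ! i))"])
        (auto simp: DL_of_kernel_iff_potential[OF h] vec_function_eq_0_iff)
  qed
  finally show ?thesis
    by (simp add: balanced_iff_potential)
qed

text \<open>A nowhere-zero potential \<open>f\<close> forces both choices to equal
  \<open>f u / f v\<close>.\<close>

lemma DL_of_unique:
  assumes "shortest_path_gain G \<phi> h" "shortest_path_gain G \<phi> h'" "balanced G \<phi>"
  shows "DL_of G h vs = DL_of G h' vs"
proof -
  obtain f w where f: "potential G \<phi> f" "w \<in> pverts G" "f w \<noteq> 0"
    using assms(3) by (auto simp: balanced_iff_potential)
  have "h u v = h' u v" if "u \<in> pverts G" "v \<in> pverts G" for u v
    using shortest_path_gain_potential[OF assms(1) f(1) that]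
      shortest_path_gain_potential[OF assms(2) f(1) that] potential_nowhere_zero[OF f that(2)]
    by simp
  then show ?thesis
    by (intro eq_matI) (auto simp: DL_of_def)
qed

text \<open>A potential vanishing at the first vertex vanishes everywhere, which gives the lower
  bound; the determinant decides whether the rank is full.\<close>

lemma rank_DL_of:
  assumes h: "shortest_path_gain G \<phi> h"
  shows "vec_space.rank (length vs) (DL_of G h vs) =
    (if balanced G \<phi> then length vs - 1 else length vs)"
proof -
  interpret vec_space "TYPE(complex)" "length vs" .
  have n: "length vs > 0"
    using pverts_nonempty set_vs by auto
  have "length vs - 1 \<le> rank (DL_of G h vs)"
  proof (rule rank_ge_pred_if_kernel_trivial_on_hyperplane[OF DL_of_carrier n])
    fix x assume x: "x \<in> carrier_vec (length vs)" "DL_of G h vs *\<^sub>v x = 0\<^sub>v (length vs)" "x $ 0 = 0"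
    obtain f where f: "x = vec (length vs) (\<lambda>i. f (vs ! i))"
      using x(1) by (rule vec_as_function)
    with x n have "potential G \<phi> f" "f (vs ! 0) = 0"
      by (auto simp: DL_of_kernel_iff_potential[OF h])
    then have "\<forall>v\<in>pverts G. f v = 0"
      using potential_nowhere_zero nth_vs[OF n] by blast
    then show "x = 0\<^sub>v (length vs)"
      by (simp add: f vec_function_eq_0_iff)
  qed
  moreover have "rank (DL_of G h vs) \<le> length vs"
    by (rule rank_le_nc[OF DL_of_carrier])
  moreover have "rank (DL_of G h vs) = length vs \<longleftrightarrow> \<not> balanced G \<phi>"
    using det_rank_iff[OF DL_of_carrier] det_DL_of_eq_0_iff[OF h] by blast
  ultimately show ?thesis
    by auto
qed

end

theorem theorem11:
  fixes G :: "'a pair_pre_digraph" and \<phi> :: "'a \<times> 'a \<Rightarrow> complex"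
    and vs :: "'a list" and n :: nat and r :: "'a rel"
  assumes "T_gain_graph G \<phi>"
    and "Digraph_Component.connected G"
    and "distinct vs" and "set vs = pverts G" and "length vs = n"
    and "strict_linear_order_on (pverts G) r"
  shows
    "(det (DL_max G \<phi> r vs) = 0 \<longleftrightarrow> det (DL_min G \<phi> r vs) = 0) \<and>
     (det (DL_min G \<phi> r vs) = 0 \<longleftrightarrow>
        DL_max G \<phi> r vs = DL_min G \<phi> r vs \<and> det (DL_max G \<phi> r vs) = 0) \<and>
     (DL_max G \<phi> r vs = DL_min G \<phi> r vs \<and> det (DL_max G \<phi> r vs) = 0 \<longleftrightarrow> balanced G \<phi>) \<and>
     (balanced G \<phi> \<longrightarrow>
        vec_space.rank n (DL_max G \<phi> r vs) = n - 1 \<and>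
        vec_space.rank n (DL_min G \<phi> r vs) = n - 1) \<and>
     (\<not> balanced G \<phi> \<longrightarrow>
        vec_space.rank n (DL_max G \<phi> r vs) = n \<and>
        vec_space.rank n (DL_min G \<phi> r vs) = n)"
proof -
  interpret T_gain_graph G \<phi> by fact
  interpret enumerated_gain_graph G \<phi> vs
    by unfold_locales fact+
  \<comment> \<open>Each determinant vanishes exactly under balance, which also makes the two
    matrices equal.\<close>
  note max = shortest_path_gain_max[of r] and min = shortest_path_gain_min[of r]
  show ?thesis
    unfolding DL_max_eq_DL_of DL_min_eq_DL_of \<open>length vs = n\<close>[symmetric]
    using det_DL_of_eq_0_iff[OF max] det_DL_of_eq_0_iff[OF min] DL_of_unique[OF max min]
      rank_DL_of[OF max] rank_DL_of[OF min]
    by auto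
qed

end
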